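(* There is no polynomial time algorithm taking as input a weakly irreducible $(d-1)$-homogeneous polynomial map $F:\mathbb{R}_{\ge0}^n\to\mathbb{R}_{\ge0}^n$ with positive rational coefficients (and a coordinate $i\in[n]$) and returning an $O(1)$-approximation of the normalized eigenvector of $F$. That is, for no constant $C>0$ does there exist an algorithm which, for every such input $(F,i)$, returns in time polynomial in the size of the input a vector $v\in\mathbb{Q}^n$ (encoded in binary) with $\|v-u\|_\infty\le C$, where $u$ is the normalized eigenvector of $F$ with $u_i=1$.
   Context: $n\ge1$, $d\ge2$ are integers (part of the input), $[n]=\{1,\dots,n\}$. $F_i(z)=\sum_{b\in\mathcal{B}_i}f_{b,i}z^b$, where $z^b=z_1^{b_1}\cdots z_n^{b_n}$, each $\mathcal{B}_i$ is a nonempty finite set of vectors $b\in\mathbb{Z}_{\ge0}^n$ with $\sum_k b_k=d-1$, and $f_{b,i}\in\mathbb{Q}$, $f_{b,i}>0$. $F$ is weakly irreducible if the Jacobian matrix of $F$ at $(1,\dots,1)^\top$ is an irreducible matrix. An eigenvector with eigenvalue $\lambda$ is a vector $z\ne0$ with $F(z)=\lambda(z_1^{d-1},\dots,z_n^{d-1})^\top$. A weakly irreducible $F$ has an eigenvector in $\mathbb{R}_{>0}^n$, unique up to a positive scalar factor; fixing a coordinate $i$, the normalized eigenvector is the unique positive eigenvector $u$ with $u_i=1$. Encoding: $\langle r\rangle$ is the number of bits of the standard binary encoding of $r\in\mathbb{Q}$, $\langle b\rangle=\sum_k\langle b_k\rangle$, and the input size is $\langle F\rangle=\sum_{i\in[n]}\sum_{b\in\mathcal{B}_i}(\langle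 b\rangle+\langle f_{b,i}\rangle)$. *)

theory Defs
  imports
    "HOL-Analysis.Derivative"
    "Jordan_Normal_Form.Matrix"
    "HOL-Computational_Algebra.Polynomial"
    "HOL-Library.List_Lexorder"
begin

unbundle no vec_syntax
hide_type (open) Finite_Cartesian_Product.vec
hide_const (open) Finite_Cartesian_Product.vec

section \<open>Homogeneous polynomial maps\<close>

text \<open>
  Coordinates are numbered from 0, so the index set is \<open>{..<n}\<close>. The degree of the map is
  \<open>d - 1\<close> with \<open>d = tens_ord F\<close>. For each \<open>i < n\<close>, \<open>supp F i\<close> is the set of exponent
  vectors of the \<open>i\<close>-th component and \<open>coef F b i\<close> is the coefficient of \<open>z^b\<close> in it; the values
  of \<open>supp\<close> and \<open>coef\<close> elsewhere are never used.
\<close>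

record poly_map =
  nvars :: nat
  tens_ord :: nat
  supp :: "nat \<Rightarrow> nat vec set"
  coef :: "nat vec \<Rightarrow> nat \<Rightarrow> rat"

definition homogeneous_map :: "poly_map \<Rightarrow> bool" where
  "homogeneous_map F \<longleftrightarrow>
     nvars F \<ge> 1 \<and> tens_ord F \<ge> 2 \<and>
     (\<forall>i<nvars F. finite (supp F i) \<and> supp F i \<noteq> {} \<and>
        (\<forall>b\<in>supp F i. b \<in> carrier_vec (nvars F) \<and>
           (\<Sum>k<nvars F. b $ k) = tens_ord F - 1 \<and> coef F b i > 0))"

definition eval_map :: "poly_map \<Rightarrow> real vec \<Rightarrow> real vec" where
  "eval_map F z = vec (nvars F)
     (\<lambda>i. \<Sum>b\<in>supp F i. of_rat (coef F b i) * (\<Prod>k<nvars F. z $ k ^ (b $ k)))"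

definition jacobian :: "poly_map \<Rightarrow> real vec \<Rightarrow> real mat" where
  "jacobian F z = mat (nvars F) (nvars F)
     (\<lambda>(i, j). deriv (\<lambda>t. eval_map F (vec (nvars F) (\<lambda>k. if k = j then t else z $ k)) $ i) (z $ j))"

text \<open>
  A square matrix is reducible if a simultaneous permutation of its rows and columns makes it
  block triangular with at least two diagonal blocks; \<open>S\<close> is the index set of one of the blocks.
\<close>

definition irreducible_matrix :: "real mat \<Rightarrow> bool" where
  "irreducible_matrix A \<longleftrightarrow>
     \<not> (\<exists>S. S \<noteq> {} \<and> S \<subset> {..<dim_row A} \<and>
          (\<forall>i\<in>S. \<forall>j\<in>{..<dim_row A} - S. A $$ (i, j) = 0))"

definition weakly_irreducible :: "poly_map \<Rightarrow> bool" where
  "weakly_irreducible F \<longleftrightarrow> irreducible_matrix (jacobian F (vec (nvars F) (\<lambda>_. 1)))"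

definition is_eigenvector :: "poly_map \<Rightarrow> real \<Rightarrow> real vec \<Rightarrow> bool" where
  "is_eigenvector F l z \<longleftrightarrow>
     z \<in> carrier_vec (nvars F) \<and> z \<noteq> 0\<^sub>v (nvars F) \<and>
     eval_map F z = l \<cdot>\<^sub>v vec (nvars F) (\<lambda>k. z $ k ^ (tens_ord F - 1))"

definition normalized_eigenvector :: "poly_map \<Rightarrow> nat \<Rightarrow> real vec \<Rightarrow> bool" where
  "normalized_eigenvector F i u \<longleftrightarrow>
     (\<exists>l. is_eigenvector F l u) \<and> (\<forall>k<nvars F. u $ k > 0) \<and> u $ i = 1"

definition linf_norm :: "real vec \<Rightarrow> real" where
  "linf_norm v = Max ((\<lambda>k. \<bar>v $ k\<bar>) ` {..<dim_vec v})"


section \<open>Binary encodings\<close>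

text \<open>Binary digits, most significant first; the number 0 is written with one digit.\<close>

fun binary :: "nat \<Rightarrow> nat list" where
  "binary n = (if n < 2 then [n] else binary (n div 2) @ [n mod 2])"

text \<open>
  The bits of a rational number are a sign bit, the digits of the numerator and the digits of the
  denominator, in lowest terms.
\<close>

definition rat_size :: "rat \<Rightarrow> nat" where
  "rat_size r = (case quotient_of r of (p, q) \<Rightarrow>
     1 + length (binary (nat \<bar>p\<bar>)) + length (binary (nat q)))"

definition map_size :: "poly_map \<Rightarrow> nat" where
  "map_size F = (\<Sum>i<nvars F. \<Sum>b\<in>supp F i.
     (\<Sum>k<nvars F. rat_size (of_nat (b $ k))) + rat_size (coef F b i))"

text \<open>
  Words are lists of tape symbols. Symbol 0 is reserved for the blank, 1 and 2 stand for the bits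
  0 and 1, and there are three separators.
\<close>

abbreviation (input) blank :: nat where "blank \<equiv> 0"
abbreviation (input) slash :: nat where "slash \<equiv> 3"
abbreviation (input) comma :: nat where "comma \<equiv> 4"
abbreviation (input) semicolon :: nat where "semicolon \<equiv> 5"

definition encode_nat :: "nat \<Rightarrow> nat list" where
  "encode_nat n = map Suc (binary n)"

definition encode_rat :: "rat \<Rightarrow> nat list" where
  "encode_rat r = (case quotient_of r of (p, q) \<Rightarrow>
     Suc (of_bool (p < 0)) # encode_nat (nat \<bar>p\<bar>) @ [slash] @ encode_nat (nat q))"

definition encode_rats :: "rat list \<Rightarrow> nat list" where
  "encode_rats rs = concat (map (\<lambda>r. encode_rat r @ [comma]) rs)"

definition encode_vec :: "rat vec \<Rightarrow> nat list" where
  "encode_vec v = encode_rats (list_of_vec v)"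

text \<open>
  The monomials of a component are listed in lexicographic order of their exponent vectors, so
  every input has exactly one encoding.
\<close>

definition encode_component :: "poly_map \<Rightarrow> nat \<Rightarrow> nat list" where
  "encode_component F i =
     concat (map (\<lambda>b. encode_rats (map of_nat (list_of_vec b) @ [coef F b i]))
       (sorted_key_list_of_set list_of_vec (supp F i))) @ [semicolon]"

definition encode_input :: "poly_map \<Rightarrow> nat \<Rightarrow> nat list" where
  "encode_input F i =
     encode_rats [of_nat (nvars F), of_nat (tens_ord F), of_nat i] @
     concat (map (encode_component F) [0..<nvars F])"


section \<open>Deterministic multitape Turing machines\<close>

datatype move = Left | Stay | Right

text \<open>
  A tape, infinite in both directions, is given by its contents and the position of its head. The
  transition function maps a state and the list of scanned symbols to the next state and, for each
  tape, the symbol to write and the move to make.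
\<close>

type_synonym tape = "(int \<Rightarrow> nat) \<times> int"
type_synonym config = "nat \<times> tape list"

record turing_machine =
  n_tapes :: nat
  n_symbols :: nat
  n_states :: nat
  start_state :: nat
  halt_state :: nat
  trans :: "nat \<Rightarrow> nat list \<Rightarrow> nat \<times> (nat \<times> move) list"

text \<open>
  States and symbols are the numbers below fixed bounds, which makes the restriction of \<open>trans\<close> to
  them a finite table. There are at least the six symbols used by the encodings and at least two
  tapes: tape 0 is the input tape and tape 1 the output tape.
\<close>

definition wf_machine :: "turing_machine \<Rightarrow> bool" where
  "wf_machine M \<longleftrightarrow>
     n_tapes M \<ge> 2 \<and> n_symbols M \<ge> 6 \<and>
     start_state M < n_states M \<and> halt_state M < n_states M \<and>
     (\<forall>q ss. q < n_states M \<and> length ss = n_tapes M \<and> set ss \<subseteq> {..<n_symbols M} \<longrightarrow>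
        (case trans M q ss of (q', as) \<Rightarrow>
           q' < n_states M \<and> length as = n_tapes M \<and> fst ` set as \<subseteq> {..<n_symbols M}))"

definition word_tape :: "nat list \<Rightarrow> tape" where
  "word_tape w = (\<lambda>x. if 0 \<le> x \<and> x < int (length w) then w ! nat x else blank, 0)"

definition scanned :: "tape \<Rightarrow> nat" where
  "scanned T = fst T (snd T)"

fun move_head :: "move \<Rightarrow> int \<Rightarrow> int" where
  "move_head Left x = x - 1"
| "move_head Stay x = x"
| "move_head Right x = x + 1"

definition act :: "nat \<times> move \<Rightarrow> tape \<Rightarrow> tape" where
  "act a T = ((fst T)(snd T := fst a), move_head (snd a) (snd T))"

definition initial_config :: "turing_machine \<Rightarrow> nat list \<Rightarrow> config" where
  "initial_config M w =
     (start_state M, word_tape w # replicate (n_tapes M - 1) (word_tape []))"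

definition step :: "turing_machine \<Rightarrow> config \<Rightarrow> config" where
  "step M c = (case c of (q, Ts) \<Rightarrow>
     if q = halt_state M then c
     else (case trans M q (map scanned Ts) of (q', as) \<Rightarrow> (q', map2 act as Ts)))"

text \<open>
  The output is the word on tape 1 that starts at cell 0 and ends before the first blank. This
  determines it, as the output words considered here are free of blanks.
\<close>

definition has_output :: "config \<Rightarrow> nat list \<Rightarrow> bool" where
  "has_output c w \<longleftrightarrow>
     (\<forall>j<length w. fst (snd c ! 1) (int j) = w ! j) \<and> fst (snd c ! 1) (int (length w)) = blank"

definition computes_within :: "turing_machine \<Rightarrow> nat list \<Rightarrow> nat list \<Rightarrow> nat \<Rightarrow> bool" where
  "computes_within M x y T \<longleftrightarrow>
     (\<exists>t\<le>T. let c = (step M ^^ t) (initial_config M x) in fst c = halt_state M \<and> has_output c y)"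


text \<open>
  For weakly irreducible \<open>F\<close> and \<open>i < nvars F\<close> there is exactly one \<open>u\<close> with
  \<open>normalized_eigenvector F i u\<close>. The polynomial \<open>p\<close> bounds the running time.
\<close>

definition approximates_eigenvector :: "turing_machine \<Rightarrow> nat poly \<Rightarrow> real \<Rightarrow> bool" where
  "approximates_eigenvector M p C \<longleftrightarrow>
     (\<forall>F i. homogeneous_map F \<and> weakly_irreducible F \<and> i < nvars F \<longrightarrow>
        (\<exists>v \<in> carrier_vec (nvars F).
           computes_within M (encode_input F i) (encode_vec v) (poly p (map_size F)) \<and>
           (\<forall>u. normalized_eigenvector F i u \<longrightarrow> linf_norm (map_vec of_rat v - u) \<le> C)))"

end

theory Submission
  imports Defs
begin

text \<open>
  Take two copies of the chain \<open>\<lambda> z\<^sub>k\<^sup>2 = c z\<^sub>0 z\<^bsub>k+1\<^esub>\<close>, \<open>k < m\<close>, where the last variable of each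
  copy is followed by the first variable of the other, with \<open>c = 1\<close> in the first copy and \<open>c = 4\<close>
  in the second. In logarithmic scale this is a Markov chain with two symmetric wells that it
  leaves after about \<open>2^m\<close> steps; since the rewards in the wells differ, the potentials of
  the wells differ by about \<open>2^m\<close>. Explicitly, \<open>\<lambda> = 2\<close> and the first variable of the second
  copy is \<open>2^(2^m - 1)\<close> if that of the first copy is 1. Writing down an approximation of this
  number takes exponentially many bits, and a machine writes at most one symbol per step.
\<close>

declare binary.simps [simp del]

section \<open>Magnitude of a rational against the length of its encoding\<close>

section \<open>Lengths of encodings\<close>

lemma binary_digit_less: "x \<in> set (binary n) \<Longrightarrow> x < 2"
proof (induction n rule: binary.induct)
  case (1 n)
  have "x \<in> set (if n < 2 then [n] else binary (n div 2) @ [n mod 2])"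
    using "1.prems" by (simp only: binary.simps[of n])
  then show ?case using "1.IH" by (auto split: if_splits)
qed

lemma less_power_length_binary: "n < 2 ^ length (binary n)"
proof (induction n rule: binary.induct)
  case (1 n)
  show ?case
  proof (cases "n < 2")
    case True
    then show ?thesis by (simp add: binary.simps)
  next
    case False
    with 1 have "n div 2 < 2 ^ length (binary (n div 2))" by blast
    then have "n < 2 * 2 ^ length (binary (n div 2))" by linarith
    with False show ?thesis by (subst binary.simps) simp
  qed
qed

text \<open>A positive denominator is at least 1, so the rational is at most the absolute value of
  its numerator, all of whose digits occur in the encoding.\<close>

lemma rat_less_power_length_encode: "real_of_rat r < 2 ^ length (encode_rat r)"
proof -
  obtain p q where pq: "quotient_of r = (p, q)" by fastforce
  then have q: "q > 0" and r: "r = of_int p / of_int q"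
    by (rule quotient_of_denom_pos, rule quotient_of_div)
  have "real_of_rat r = of_int p / of_int q"
    by (simp add: r of_rat_divide)
  also have "\<dots> \<le> \<bar>of_int p\<bar> / 1"
    using q by (intro frac_le) auto
  also have "\<dots> = of_nat (nat \<bar>p\<bar>)" by simp
  also have "\<dots> < 2 ^ length (binary (nat \<bar>p\<bar>))"
    using less_power_length_binary[of "nat \<bar>p\<bar>"]
    by (metis of_nat_less_iff of_nat_numeral of_nat_power)
  also have "\<dots> \<le> 2 ^ length (encode_rat r)"
    by (intro power_increasing) (auto simp: encode_rat_def encode_nat_def pq)
  finally show ?thesis .
qed

lemma length_encode_rat_le:
  assumes "r \<in> set rs"
  shows "length (encode_rat r) \<le> length (encode_rats rs)"
proof -
  have "length (encode_rat r) \<le> length (encode_rat r @ [comma])" by simp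
  also have "\<dots> \<le> length (encode_rats rs)"
    using assms unfolding encode_rats_def length_concat map_map
    by (intro member_le_sum_list) auto
  finally show ?thesis .
qed

text \<open>Digits are shifted to 1 and 2 and the separators are larger, so an encoded output
  contains no blank.\<close>

lemma set_encode_rats: "set (encode_rats rs) \<subseteq> {1..<6}"
proof -
  have "x \<in> {1..<6}" if "x \<in> set (encode_nat n)" for x n
    using that by (auto simp: encode_nat_def dest: binary_digit_less)
  then have "set (encode_rat r) \<subseteq> {1..<6}" for r
    by (auto simp: encode_rat_def split: prod.splits)
  then show ?thesis by (auto simp: encode_rats_def subset_iff)
qed

lemma set_encode_input: "set (encode_input F i) \<subseteq> {..<6}"
proof -
  have rats: "x < 6" if "x \<in> set (encode_rats rs)" for x rs
    using that set_encode_rats[of rs] by auto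
  have "set (encode_component F k) \<subseteq> {..<6}" for k
    by (auto simp: encode_component_def dest: rats)
  then show ?thesis
    by (fastforce simp: encode_input_def dest: rats)
qed

section \<open>Growth of the written part of a tape\<close>

section \<open>Output length and running time\<close>

text \<open>The number of these cells serves as a potential: a step raises it by at most
  one.\<close>

definition nonblank_cells :: "tape \<Rightarrow> int set" where
  "nonblank_cells T = {x. fst T x \<noteq> blank}"

lemma nonblank_cells_act: "nonblank_cells (act a T) \<subseteq> insert (snd T) (nonblank_cells T)"
  by (auto simp: nonblank_cells_def act_def)

text \<open>The invariant under which \<open>wf_machine\<close> constrains \<open>trans\<close>; in
  particular it keeps \<open>map2\<close> from dropping tapes.\<close>

definition wf_config :: "turing_machine \<Rightarrow> config \<Rightarrow> bool" where
  "wf_config M c \<longleftrightarrow> fst c < n_states M \<and> length (snd c) = n_tapes M \<and>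
     (\<forall>T\<in>set (snd c). range (fst T) \<subseteq> {..<n_symbols M})"

lemma wf_initial_config:
  assumes "wf_machine M" "set w \<subseteq> {..<n_symbols M}"
  shows "wf_config M (initial_config M w)"
  using assms
  by (auto simp: wf_config_def initial_config_def wf_machine_def word_tape_def subset_iff)

text \<open>The unchanged tape accounts for the halting state; in any other state every tape
  undergoes one action.\<close>

lemma step_tape:
  assumes M: "wf_machine M" and c: "wf_config M c"
  shows "wf_config M (step M c) \<and>
    (\<forall>k<n_tapes M. snd (step M c) ! k = snd c ! k \<or> (\<exists>a. snd (step M c) ! k = act a (snd c ! k)))"
proof (cases "fst c = halt_state M")
  case True
  then show ?thesis using c by (simp add: step_def split_beta)
next
  case False
  obtain q Ts where qT: "c = (q, Ts)" by fastforce
  obtain q' as where t: "trans M q (map scanned Ts) = (q', as)" by fastforce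
  have sym: "fst T x < n_symbols M" if "T \<in> set Ts" for T x
    using c that by (auto simp: wf_config_def qT)
  have "set (map scanned Ts) \<subseteq> {..<n_symbols M}"
    using sym by (auto simp: scanned_def)
  moreover have "q < n_states M" and len: "length Ts = n_tapes M"
    using c by (auto simp: wf_config_def qT)
  ultimately have "case trans M q (map scanned Ts) of (q', as) \<Rightarrow>
      q' < n_states M \<and> length as = n_tapes M \<and> fst ` set as \<subseteq> {..<n_symbols M}"
    using M unfolding wf_machine_def by (simp only: length_map)
  then have new: "q' < n_states M" "length as = n_tapes M" "fst ` set as \<subseteq> {..<n_symbols M}"
    by (simp_all add: t)
  have s: "step M (q, Ts) = (q', map2 act as Ts)"
    using False by (simp add: step_def qT t)
  have nth: "map2 act as Ts ! k = act (as ! k) (Ts ! k)" if "k < n_tapes M" for k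
    using that new(2) len by simp
  moreover have "range (fst T) \<subseteq> {..<n_symbols M}" if T: "T \<in> set (map2 act as Ts)" for T
  proof -
    obtain k where k: "k < n_tapes M" "T = act (as ! k) (Ts ! k)"
      using T[unfolded in_set_conv_nth] new(2) len by (auto simp: nth)
    then have "as ! k \<in> set as" "Ts ! k \<in> set Ts" using new(2) len by simp_all
    then show ?thesis
      using new(3) sym[of "Ts ! k"] by (auto simp: k act_def)
  qed
  ultimately show ?thesis
    unfolding qT s wf_config_def fst_conv snd_conv using new(1,2) len by (auto simp del: nth_map split_paired_Ex)
qed

text \<open>Every tape except the input tape starts blank. Finiteness is part of the induction
  because an infinite set has cardinality 0.\<close>

lemma nonblank_cells_steps:
  assumes M: "wf_machine M" and w: "set w \<subseteq> {..<n_symbols M}" and k: "0 < k" "k < n_tapes M"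
  defines "c \<equiv> \<lambda>t. (step M ^^ t) (initial_config M w)"
  shows "wf_config M (c t) \<and> finite (nonblank_cells (snd (c t) ! k)) \<and>
    card (nonblank_cells (snd (c t) ! k)) \<le> t"
proof (induction t)
  case 0
  have "nonblank_cells (snd (c 0) ! k) = {}"
    using k by (auto simp: c_def initial_config_def nonblank_cells_def word_tape_def nth_Cons')
  then show ?case
    using wf_initial_config[OF M w] by (simp add: c_def)
next
  case (Suc t)
  let ?T = "snd (c t) ! k" and ?T' = "snd (c (Suc t)) ! k"
  have c: "c (Suc t) = step M (c t)" by (simp add: c_def)
  with Suc step_tape[OF M] k(2)
  have wf: "wf_config M (c (Suc t))" and "?T' = ?T \<or> (\<exists>a. ?T' = act a ?T)" by auto
  then have sub: "nonblank_cells ?T' \<subseteq> insert (snd ?T) (nonblank_cells ?T)"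
    by (elim disjE exE) (simp_all only: nonblank_cells_act subset_insertI)
  moreover have fin: "finite (insert (snd ?T) (nonblank_cells ?T))" using Suc by simp
  ultimately have "card (nonblank_cells ?T') \<le> card (insert (snd ?T) (nonblank_cells ?T))"
    by (rule card_mono[rotated])
  also have "\<dots> \<le> Suc t"
    using Suc by (simp add: card_insert_if)
  finally show ?case using wf finite_subset[OF sub fin] by simp
qed

text \<open>The symbols of a blank-free output sit in distinct nonblank cells of tape 1, which
  starts blank.\<close>

lemma length_output_le:
  assumes M: "wf_machine M" and w: "set w \<subseteq> {..<n_symbols M}"
    and y: "blank \<notin> set y" and comp: "computes_within M w y T"
  shows "length y \<le> T"
proof -
  obtain t where t: "t \<le> T" "has_output ((step M ^^ t) (initial_config M w)) y"
    using comp by (auto simp: computes_within_def Let_def)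
  let ?S = "nonblank_cells (snd ((step M ^^ t) (initial_config M w)) ! 1)"
  have "1 < n_tapes M" using M by (simp add: wf_machine_def)
  with nonblank_cells_steps[OF M w, of 1 t] have S: "finite ?S" "card ?S \<le> t" by auto
  have "int ` {..<length y} \<subseteq> ?S"
    using t(2) y by (auto simp: has_output_def nonblank_cells_def in_set_conv_nth)
  then have "card (int ` {..<length y}) \<le> card ?S" by (rule card_mono[OF S(1)])
  then show ?thesis using S(2) t(1) by (simp add: card_image)
qed

section \<open>Small maps with doubly exponential eigenvector entries\<close>

section \<open>The two-well map\<close>

definition well_start :: "nat \<Rightarrow> nat \<Rightarrow> nat" where
  "well_start m k = (if k < m then 0 else m)"

definition next_index :: "nat \<Rightarrow> nat \<Rightarrow> nat" where
  "next_index m k = (if Suc k = 2 * m then 0 else Suc k)"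

text \<open>Exponents 0 and 1 suffice because the two indices differ for every
  \<open>k < 2 * m\<close>.\<close>

definition well_exponent :: "nat \<Rightarrow> nat \<Rightarrow> nat vec" where
  "well_exponent m k = vec (2 * m) (\<lambda>j. of_bool (j \<in> {well_start m k, next_index m k}))"

definition well_coef :: "nat \<Rightarrow> nat \<Rightarrow> rat" where
  "well_coef m k = (if k < m then 1 else 4)"

definition two_well_map :: "nat \<Rightarrow> poly_map" where
  "two_well_map m = \<lparr>nvars = 2 * m, tens_ord = 3, supp = \<lambda>k. {well_exponent m k},
     coef = \<lambda>_. well_coef m\<rparr>"

lemma two_well_map_simps [simp]:
  "nvars (two_well_map m) = 2 * m" "tens_ord (two_well_map m) = 3"
  "supp (two_well_map m) k = {well_exponent m k}" "coef (two_well_map m) b = well_coef m"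
  by (simp_all add: two_well_map_def)

lemma well_indices:
  assumes "k < 2 * m"
  shows "well_start m k < 2 * m" "next_index m k < 2 * m" "well_start m k \<noteq> next_index m k"
  using assms by (auto simp: well_start_def next_index_def)

lemma homogeneous_two_well_map:
  assumes "m > 0"
  shows "homogeneous_map (two_well_map m)"
proof -
  have "(\<Sum>j<2 * m. well_exponent m k $ j) = 2" if "k < 2 * m" for k
  proof -
    have "(\<Sum>j<2 * m. well_exponent m k $ j) =
        (\<Sum>j<2 * m. of_bool (j \<in> {well_start m k, next_index m k}))"
      by (intro sum.cong) (auto simp: well_exponent_def)
    also have "\<dots> = card ({..<2 * m} \<inter> {well_start m k, next_index m k})"
      by (subst sum_of_bool_eq) (simp_all only: finite_lessThan Collect_mem_eq of_nat_id)
    also have "{..<2 * m} \<inter> {well_start m k, next_index m k} = {well_start m k, next_index m k}"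
      using well_indices[OF that] by auto
    finally show ?thesis using well_indices[OF that] by simp
  qed
  then show ?thesis
    using assms by (auto simp: homogeneous_map_def well_coef_def well_exponent_def)
qed

lemma eval_two_well_map:
  assumes "k < 2 * m"
  shows "eval_map (two_well_map m) z $ k =
    of_rat (well_coef m k) * (z $ well_start m k * z $ next_index m k)"
proof -
  have "(\<Prod>j<2 * m. z $ j ^ (well_exponent m k $ j)) =
      (\<Prod>j<2 * m. if j \<in> {well_start m k, next_index m k} then z $ j else 1)"
    by (intro prod.cong) (auto simp: well_exponent_def)
  also have "\<dots> = (\<Prod>j\<in>{well_start m k, next_index m k}. z $ j)"
    using well_indices[OF assms] by (subst prod.inter_restrict[symmetric]) (auto intro!: prod.cong)
  finally show ?thesis
    using assms well_indices[OF assms] by (simp add: eval_map_def)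
qed

lemma jacobian_two_well_map_next:
  assumes "k < 2 * m"
  shows "jacobian (two_well_map m) (vec (2 * m) (\<lambda>_. 1)) $$ (k, next_index m k) \<noteq> 0"
proof -
  \<comment> \<open>The other factor is a different coordinate, fixed at 1, so the component is
    linear in the next coordinate.\<close>
  have "((\<lambda>t. of_rat (well_coef m k) * t) has_field_derivative of_rat (well_coef m k)) (at (1::real))"
    by (auto intro!: derivative_eq_intros)
  from DERIV_imp_deriv[OF this] show ?thesis
    using assms well_indices[OF assms]
    by (simp add: jacobian_def eval_two_well_map well_coef_def)
qed

text \<open>The nonzero entries contain a cycle through all indices, so every nonempty proper subset
  has an entry leaving it.\<close>

lemma weakly_irreducible_two_well_map: "weakly_irreducible (two_well_map m)"
  unfolding weakly_irreducible_def irreducible_matrix_def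
proof (rule notI, elim exE conjE)
  let ?A = "jacobian (two_well_map m) (vec (nvars (two_well_map m)) (\<lambda>_. 1))"
  fix S
  assume S: "S \<noteq> {}" "S \<subset> {..<dim_row ?A}"
    and zero: "\<forall>i\<in>S. \<forall>j\<in>{..<dim_row ?A} - S. ?A $$ (i, j) = 0"
  have dim: "dim_row ?A = 2 * m" by (simp add: jacobian_def)
  have closed: "next_index m k \<in> S" if "k \<in> S" for k
  proof (rule ccontr)
    assume "next_index m k \<notin> S"
    moreover have k: "k < 2 * m" using that S(2) dim by auto
    ultimately have "?A $$ (k, next_index m k) = 0"
      using zero that well_indices(2)[OF k] dim by simp
    with jacobian_two_well_map_next[OF k] show False by simp
  qed
  obtain k where k: "k \<in> S" "k < 2 * m" using S dim by auto
  have up: "j \<in> S" if "j' \<in> S" "j' \<le> j" "j < 2 * m" for j j'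
    using that(2,1,3)
  proof (induction rule: dec_induct)
    case (step i)
    then show ?case using closed[of i] by (simp add: next_index_def)
  qed
  have "2 * m - 1 \<in> S" using up[OF k(1)] k(2) by simp
  then have "0 \<in> S" using closed[of "2 * m - 1"] k(2) by (simp add: next_index_def)
  then have "{..<2 * m} \<subseteq> S" using up by auto
  with S(2) dim show False by auto
qed

text \<open>For eigenvalue 2 the base-2 logarithms start at 0 and follow
  \<open>x \<mapsto> 2 * x + 1\<close> in the first copy and
  \<open>x \<mapsto> 2 * x - 2 ^ m\<close> in the second. On the index range no subtraction is
  truncated.\<close>

definition well_eigenvector :: "nat \<Rightarrow> real vec" where
  "well_eigenvector m = vec (2 * m)
     (\<lambda>k. if k < m then 2 ^ (2 ^ k - 1) else 2 ^ (2 ^ m - 2 ^ (k - m)))"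

lemma normalized_eigenvector_two_well_map:
  assumes "m > 0"
  shows "normalized_eigenvector (two_well_map m) 0 (well_eigenvector m)"
proof -
  let ?u = "well_eigenvector m"
  have u0: "?u $ 0 = 1" and um: "?u $ m = 2 ^ (2 ^ m - 1)"
    using assms by (auto simp: well_eigenvector_def)
  have eq: "of_rat (well_coef m k) * (?u $ well_start m k * ?u $ next_index m k) = 2 * (?u $ k)\<^sup>2"
    if k: "k < 2 * m" for k
  proof (cases "k < m")
    case True
    \<comment> \<open>At \<open>Suc k = m\<close> the formula of the second copy applies; both
      formulas agree there.\<close>
    have "?u $ Suc k = 2 ^ (2 ^ Suc k - 1)"
      using True by (cases "Suc k = m") (auto simp: well_eigenvector_def)
    moreover have "(2::nat) ^ Suc k - 1 = Suc ((2 ^ k - 1) * 2)"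
    proof -
      have "(1::nat) \<le> 2 ^ k" by simp
      then have "2 * 2 ^ k - 1 = Suc ((2 ^ k - 1) * 2 :: nat)" by linarith
      then show ?thesis by simp
    qed
    moreover have "next_index m k = Suc k" using True by (simp add: next_index_def)
    ultimately show ?thesis
      using True k u0 by (simp add: well_coef_def well_start_def well_eigenvector_def power_mult)
  next
    case False
    define j where "j = k - m"
    have j: "k = m + j" "j < m" using False k by (auto simp: j_def)
    have "?u $ next_index m k = 2 ^ (2 ^ m - 2 ^ Suc j)"
    \<comment> \<open>The last index wraps around to 0, whose value 1 continues the formula:
      \<open>2 ^ m - 2 ^ m = 0\<close>.\<close>
    proof (cases "Suc j = m")
      case True
      then show ?thesis using u0 j by (simp add: next_index_def flip: power_Suc)
    next
      case False
      then show ?thesis using j by (simp add: next_index_def well_eigenvector_def)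
    qed
    moreover have "(4::real) * (2 ^ (2 ^ m - 1) * 2 ^ (2 ^ m - 2 ^ Suc j)) =
        2 * (2 ^ (2 ^ m - 2 ^ j))\<^sup>2"
    proof -
      have "(2::nat) ^ Suc j \<le> 2 ^ m" using j by (intro power_increasing) auto
      moreover have "(1::nat) \<le> 2 ^ m" by simp
      \<comment> \<open>In this identity of exponents the summand 2 stands for the coefficient 4 and
        \<open>Suc\<close> for the eigenvalue 2.\<close>
      ultimately have "2 + (2 ^ m - 1 + (2 ^ m - 2 ^ Suc j)) = Suc ((2 ^ m - 2 ^ j) * 2 :: nat)"
        unfolding power_Suc by linarith
      then have "(2::real) ^ (2 + (2 ^ m - 1 + (2 ^ m - 2 ^ Suc j))) =
          2 ^ Suc ((2 ^ m - 2 ^ j) * 2)"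
        by (rule arg_cong)
      then show ?thesis by (simp only: power_add power_Suc power_mult) simp
    qed
    moreover have "?u $ k = 2 ^ (2 ^ m - 2 ^ j)" using j by (simp add: well_eigenvector_def)
    ultimately show ?thesis
      using False um by (simp add: well_coef_def well_start_def)
  qed
  have "is_eigenvector (two_well_map m) 2 ?u"
    unfolding is_eigenvector_def
  proof (intro conjI)
    show "?u \<in> carrier_vec (nvars (two_well_map m))" by (simp add: well_eigenvector_def)
    show "?u \<noteq> 0\<^sub>v (nvars (two_well_map m))"
      using u0 assms by (auto dest: arg_cong[of _ _ "\<lambda>v. v $ 0"])
    show "eval_map (two_well_map m) ?u = 2 \<cdot>\<^sub>v vec (nvars (two_well_map m))
        (\<lambda>k. ?u $ k ^ (tens_ord (two_well_map m) - 1))"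
    proof (rule eq_vecI)
      fix k
      assume "k < dim_vec (2 \<cdot>\<^sub>v vec (nvars (two_well_map m))
        (\<lambda>k. ?u $ k ^ (tens_ord (two_well_map m) - 1)))"
      then have "k < 2 * m" by simp
      then show "eval_map (two_well_map m) ?u $ k = (2 \<cdot>\<^sub>v vec (nvars (two_well_map m))
        (\<lambda>k. ?u $ k ^ (tens_ord (two_well_map m) - 1))) $ k"
        by (simp add: eval_two_well_map eq)
    qed (simp add: eval_map_def)
  qed
  then show ?thesis
    using u0 by (auto simp: normalized_eigenvector_def well_eigenvector_def)
qed

text \<open>There are \<open>4 * m\<^sup>2\<close> exponents of 3 bits each and \<open>2 * m\<close>
  coefficients of at most 5 bits; finally \<open>m \<le> m\<^sup>2\<close>.\<close>

lemma map_size_two_well_map: "map_size (two_well_map m) \<le> 26 * m\<^sup>2"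
proof -
  have [simp]: "binary 0 = [0]" "binary 1 = [1]" "binary (Suc 0) = [1]" "binary 4 = [1, 0, 0]"
    by (simp_all add: binary.simps)
  have sizes: "rat_size 0 = 3" "rat_size 1 = 3" "rat_size 4 = 5"
    by (simp_all add: rat_size_def)
  have "map_size (two_well_map m) =
      (\<Sum>i<2 * m. (\<Sum>k<2 * m. rat_size (of_nat (well_exponent m i $ k))) + rat_size (well_coef m i))"
    by (simp add: map_size_def)
  also have "\<dots> \<le> (\<Sum>i<2 * m. (\<Sum>k<2 * m. 3) + 5)"
    by (intro sum_mono add_mono) (auto simp: well_exponent_def well_coef_def sizes)
  also have "\<dots> = 12 * m\<^sup>2 + 10 * m" by (simp add: power2_eq_square algebra_simps)
  also have "\<dots> \<le> 26 * m\<^sup>2" by (simp add: power2_eq_square le_square)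
  finally show ?thesis .
qed

section \<open>Polynomial running time against exponential output length\<close>

section \<open>The lower bound\<close>

lemma abs_index_le_linf_norm: "k < dim_vec v \<Longrightarrow> \<bar>v $ k\<bar> \<le> linf_norm v"
  by (auto simp: linf_norm_def)

lemma poly_mono_nat:
  fixes p :: "nat poly"
  assumes "x \<le> y"
  shows "poly p x \<le> poly p y"
  by (induction p) (auto intro: add_mono mult_mono assms)

text \<open>Induction along the Horner form with the base \<open>c\<close> arbitrary: writing
  \<open>c = s * s\<close> gives one power of \<open>s\<close> to the factor \<open>m\<close> and
  one to the remaining polynomial.\<close>

lemma poly_over_power_tendsto_0:
  fixes p :: "nat poly" and c :: real
  assumes "c > 1"
  shows "(\<lambda>m. real (poly p m) / c ^ m) \<longlonglongrightarrow> 0"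
  using assms
proof (induction p arbitrary: c)
  case (pCons a p)
  define s where "s = sqrt c"
  have s: "s > 1" "c = s * s" using pCons.prems by (auto simp: s_def)
  have "(\<lambda>m. real a * inverse (c ^ m) + real m / s ^ m * (real (poly p m) / s ^ m)) \<longlonglongrightarrow> real a * 0 + 0 * 0"
    using pCons.IH[OF s(1)] LIMSEQ_inverse_realpow_zero[OF pCons.prems] powser_times_n_limit_0[of "inverse s"] s(1)
    by (intro tendsto_intros) (auto simp: field_simps power_inverse)
  also have "(\<lambda>m. real a * inverse (c ^ m) + real m / s ^ m * (real (poly p m) / s ^ m)) =
      (\<lambda>m. real (poly (pCons a p) m) / c ^ m)"
    using s by (auto simp: field_simps power_mult_distrib)
  finally show ?case by simp
qed simp

lemma eventually_poly_less_two_power: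
  fixes p :: "nat poly"
  shows "eventually (\<lambda>m. poly p m < 2 ^ m) sequentially"
proof -
  have "eventually (\<lambda>m. real (poly p m) / 2 ^ m < 1) sequentially"
    using poly_over_power_tendsto_0[of 2 p] by (intro order_tendstoD) auto
  then show ?thesis
  proof eventually_elim
    case (elim m)
    then have "real (poly p m) < real (2 ^ m)" by simp
    then show ?case by (simp only: of_nat_less_iff)
  qed
qed

text \<open>Entry \<open>m\<close> of the eigenvector is twice \<open>2 ^ (2 ^ m - 2)\<close>. An
  error of at most half of it leaves a number that needs more than \<open>2 ^ m - 2\<close>
  symbols.\<close>

lemma two_well_output_length:
  assumes m: "m > 0" and v: "v \<in> carrier_vec (2 * m)"
    and close: "linf_norm (map_vec of_rat v - well_eigenvector m) \<le> C"
    and C: "C \<le> 2 ^ (2 ^ m - 2)"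
  shows "2 ^ m - 2 < length (encode_vec v)"
proof -
  have vm: "v $ m \<in> set (list_of_vec v)"
    using m v by (auto simp: set_list_of_vec vec_set_def)
  have "\<bar>of_rat (v $ m) - 2 ^ (2 ^ m - 1)\<bar> \<le> C"
    using abs_index_le_linf_norm[of m "map_vec of_rat v - well_eigenvector m"] close m v
    by (simp add: well_eigenvector_def)
  moreover have "(2::real) ^ (2 ^ m - 1) = 2 * 2 ^ (2 ^ m - 2)"
  proof -
    have "(2::nat) \<le> 2 ^ m" using m power_increasing[of 1 m "2::nat"] by simp
    then have "(2::nat) ^ m - 1 = Suc (2 ^ m - 2)" by simp
    then show ?thesis by (simp only: power_Suc)
  qed
  ultimately have "2 ^ (2 ^ m - 2) \<le> real_of_rat (v $ m)" using C by linarith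
  also have "\<dots> < 2 ^ length (encode_rat (v $ m))" by (rule rat_less_power_length_encode)
  also have "\<dots> \<le> 2 ^ length (encode_vec v)"
    unfolding encode_vec_def by (intro power_increasing length_encode_rat_le vm) simp
  finally show ?thesis by (simp only: power_strict_increasing_iff)
qed

theorem theorem1p7:
  fixes C :: real
  assumes "C > 0"
  shows "\<not> (\<exists>(M :: turing_machine) (p :: nat poly).
           wf_machine M \<and> approximates_eigenvector M p C)"
proof (rule notI, elim exE conjE)
  fix M :: turing_machine and p :: "nat poly"
  assume M: "wf_machine M" and approx: "approximates_eigenvector M p C"
  \<comment> \<open>The composition turns the time bound into a polynomial in \<open>m\<close>; the
    2 compensates for the 2 subtracted in the output length.\<close>
  define q where "q = pcompose p [:0, 0, 26:] + [:2:]"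
  obtain c where "C < 2 ^ c" using real_arch_pow[of 2 C] by auto
  \<comment> \<open>The constant polynomial makes \<open>2 ^ m - 2\<close> exceed \<open>c\<close>,
    so that the error \<open>C\<close> is small enough.\<close>
  have "eventually (\<lambda>m. m > 0 \<and> poly q m < 2 ^ m \<and> poly [:c + 2:] m < 2 ^ m) sequentially"
    by (intro eventually_conj eventually_poly_less_two_power eventually_gt_at_top)
  then obtain m where m: "m > 0" and q: "poly q m < 2 ^ m" and c: "c + 2 < 2 ^ m"
    by (auto simp: eventually_sequentially)
  note \<open>C < 2 ^ c\<close>
  also have "(2::real) ^ c \<le> 2 ^ (2 ^ m - 2)" using c by (intro power_increasing) auto
  finally have C: "C \<le> 2 ^ (2 ^ m - 2)" by simp
  let ?F = "two_well_map m"
  obtain v where v: "v \<in> carrier_vec (2 * m)"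
    and comp: "computes_within M (encode_input ?F 0) (encode_vec v) (poly p (map_size ?F))"
    and close: "linf_norm (map_vec of_rat v - well_eigenvector m) \<le> C"
    using approx[unfolded approximates_eigenvector_def, rule_format, of ?F 0]
      homogeneous_two_well_map[OF m] weakly_irreducible_two_well_map[of m]
      normalized_eigenvector_two_well_map[OF m] m by auto
  have "2 ^ m - 2 < length (encode_vec v)"
    by (rule two_well_output_length[OF m v close C])
  also have "\<dots> \<le> poly p (map_size ?F)"
  proof (rule length_output_le[OF M _ _ comp])
    show "set (encode_input ?F 0) \<subseteq> {..<n_symbols M}"
      using M set_encode_input[of ?F 0] by (auto simp: wf_machine_def)
    show "blank \<notin> set (encode_vec v)"
      using set_encode_rats by (fastforce simp: encode_vec_def)
  qed
  also have "\<dots> \<le> poly p (26 * m\<^sup>2)"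
    by (rule poly_mono_nat[OF map_size_two_well_map])
  also have "\<dots> + 2 = poly q m"
    by (simp add: q_def poly_pcompose power2_eq_square algebra_simps)
  finally show False using q by linarith
qed

end
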